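(* Let $l$ be a complete lattice which is a de Morgan algebra with residual implication. Let $TS=(S,Act,\to,I,AP,L)$ be an mv-transition system without terminal states, and let $P:(2^{AP})^{\omega}\to l$ satisfy $L_\omega(\mathcal A)=P$ for some $l$-valued deterministic Rabin automaton $\mathcal A=(Q,2^{AP},\delta,q_0,\mathcal F)$. Then $TS\models P$ if and only if $TS\otimes\mathcal A\models d(\mathcal A)$.
   Context: $l$: complete distributive lattice with $x\wedge\bigvee a_i=\bigvee(x\wedge a_i)$, de Morgan negation and implication $a\to b=\bigvee\{c:a\wedge c\le b\}$. An mv-TS is $(S,Act,\to,I,AP,L)$ with finite $S,Act,AP$, transition map $\eta:S\times Act\times S\to l$, $I:S\to l$, labeling $L:S\to2^{AP}$; no terminal states means every $s$ has $\alpha,s'$ with $\eta(s,\alpha,s')>0$. For $\rho=s_0\alpha_1s_1\cdots$, $v(\rho)=I(s_0)\wedge\bigwedge_i\eta(s_i,\alpha_{i+1},s_{i+1})$; $\mathrm{Traces}(TS)(\sigma)=\bigvee\{v(\rho):L(s_0)L(s_1)\cdots=\sigma\}$; $TS\models P$ iff $\mathrm{Traces}(TS)(\sigma)\le P(\sigma)$ for all $\sigma$. An $l$-VDRA $(Q,\Sigma,\delta,q_0,\mathcal F)$ has finite $Q$, $\delta:Q\times\Sigma\to Q$, $q_0\in Q$, $\mathcal F:2^Q\times2^Q\to l$; for $w=A_0A_1\cdots$ with run $q_{i+1}=\delta(q_i,A_i)$, $L_\omega(\mathcal A)(w)=\bigvee\{\mathcal F(H,K):(\exists n\,\forall m\ge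 n.\ q_m\notin H)\wedge(\forall n\,\exists m\ge n.\ q_m\in K)\}$. The product $TS\otimes\mathcal A=(S\times Q,Act,\to',I',AP',L')$ has $AP'=2^Q$; $\eta'((s,q),\alpha,(t,p))=\eta(s,\alpha,t)$ if $\delta(q,L(t))=p$, else $0$; $I'(s,q)=I(s)$ if $\delta(q_0,L(s))=q$, else $0$; $L'(s,q)=\{H\subseteq Q:q\in H\}$. The property $d(\mathcal A):(2^{AP'})^{\omega}\to l$ is $d(\mathcal A)(B_0B_1\cdots)=\bigvee\{\mathcal F(H,K):(\exists n\,\forall m\ge n.\ H\notin B_m)\wedge(\forall n\,\exists m\ge n.\ K\in B_m)\}$. *)

theory Defs
  imports Main
begin

text \<open>
  The truth values are the elements of a type. The library class \<open>complete_distrib_lattice\<close> is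
  not used for them: it demands complete distributivity, which is stronger than the distributivity
  of meets over arbitrary joins that is required here.
\<close>

class de_morgan_algebra = distrib_lattice + bounded_lattice + uminus +
  assumes minus_minus_id: "- (- x) = x"
    and minus_sup: "- (sup x y) = inf (- x) (- y)"
    and minus_inf: "- (inf x y) = sup (- x) (- y)"

class residual_de_morgan_algebra = complete_lattice + de_morgan_algebra +
  assumes inf_Sup_distrib: "inf x (Sup A) = (SUP a\<in>A. inf x a)"

definition residuum :: "'l \<Rightarrow> 'l \<Rightarrow> 'l::residual_de_morgan_algebra" where
  "residuum a b = Sup {c. inf a c \<le> b}"

lemma residuum_adjoint: "inf a c \<le> b \<longleftrightarrow> c \<le> residuum a b"
proof
  assume "inf a c \<le> b"
  then show "c \<le> residuum a b"
    by (auto simp: residuum_def intro: Sup_upper)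
next
  assume "c \<le> residuum a b"
  then have "inf a c \<le> inf a (Sup {c. inf a c \<le> b})"
    by (simp add: residuum_def le_infI2)
  also have "\<dots> \<le> b"
    by (auto simp: inf_Sup_distrib intro: SUP_least)
  finally show "inf a c \<le> b" .
qed

text \<open>
  Infinite words are functions on the naturals. Systems and automata have explicit carrier sets;
  the values of their component functions outside the carriers are never consulted.
\<close>

definition omega_words :: "'b set \<Rightarrow> (nat \<Rightarrow> 'b) set" where
  "omega_words \<Sigma> = {w. \<forall>i. w i \<in> \<Sigma>}"

record ('s, 'a, 'p, 'l) mvts =
  states :: "'s set"
  acts :: "'a set"
  trans_val :: "'s \<Rightarrow> 'a \<Rightarrow> 's \<Rightarrow> 'l"
  init_val :: "'s \<Rightarrow> 'l"
  props :: "'p set"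
  label :: "'s \<Rightarrow> 'p set"

definition is_mvts :: "('s, 'a, 'p, 'l::residual_de_morgan_algebra) mvts \<Rightarrow> bool" where
  "is_mvts TS \<longleftrightarrow> finite (states TS) \<and> finite (acts TS) \<and> finite (props TS) \<and>
    (\<forall>s\<in>states TS. label TS s \<subseteq> props TS)"

definition no_terminal_states :: "('s, 'a, 'p, 'l::residual_de_morgan_algebra) mvts \<Rightarrow> bool" where
  "no_terminal_states TS \<longleftrightarrow>
    (\<forall>s\<in>states TS. \<exists>\<alpha>\<in>acts TS. \<exists>s'\<in>states TS. trans_val TS s \<alpha> s' > bot)"

text \<open>
  A path \<open>s\<^sub>0 \<alpha>\<^sub>1 s\<^sub>1 \<alpha>\<^sub>2 \<dots>\<close> is a pair \<open>(s, a)\<close> of sequences in which \<open>a i\<close> is the action \<open>\<alpha>\<^sub>i\<^sub>+\<^sub>1\<close>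
  that leads from \<open>s i\<close> to \<open>s (Suc i)\<close>.
\<close>

definition paths :: "('s, 'a, 'p, 'l) mvts \<Rightarrow> ((nat \<Rightarrow> 's) \<times> (nat \<Rightarrow> 'a)) set" where
  "paths TS = omega_words (states TS) \<times> omega_words (acts TS)"

fun path_val ::
  "('s, 'a, 'p, 'l::residual_de_morgan_algebra) mvts \<Rightarrow> (nat \<Rightarrow> 's) \<times> (nat \<Rightarrow> 'a) \<Rightarrow> 'l" where
  "path_val TS (s, a) = inf (init_val TS (s 0)) (INF i. trans_val TS (s i) (a i) (s (Suc i)))"

fun path_trace :: "('s, 'a, 'p, 'l) mvts \<Rightarrow> (nat \<Rightarrow> 's) \<times> (nat \<Rightarrow> 'a) \<Rightarrow> nat \<Rightarrow> 'p set" where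
  "path_trace TS (s, a) = (\<lambda>i. label TS (s i))"

definition traces ::
  "('s, 'a, 'p, 'l::residual_de_morgan_algebra) mvts \<Rightarrow> (nat \<Rightarrow> 'p set) \<Rightarrow> 'l" where
  "traces TS \<sigma> = Sup {path_val TS \<rho> | \<rho>. \<rho> \<in> paths TS \<and> path_trace TS \<rho> = \<sigma>}"

definition satisfies ::
  "('s, 'a, 'p, 'l::residual_de_morgan_algebra) mvts \<Rightarrow> ((nat \<Rightarrow> 'p set) \<Rightarrow> 'l) \<Rightarrow> bool" where
  "satisfies TS P \<longleftrightarrow> (\<forall>\<sigma>\<in>omega_words (Pow (props TS)). traces TS \<sigma> \<le> P \<sigma>)"

record ('q, 'b, 'l) vdra =
  locs :: "'q set"
  alphabet :: "'b set"
  step :: "'q \<Rightarrow> 'b \<Rightarrow> 'q"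
  start :: "'q"
  acc_val :: "'q set \<Rightarrow> 'q set \<Rightarrow> 'l"

definition is_vdra :: "('q, 'b, 'l::residual_de_morgan_algebra) vdra \<Rightarrow> bool" where
  "is_vdra A \<longleftrightarrow> finite (locs A) \<and> start A \<in> locs A \<and>
    (\<forall>q\<in>locs A. \<forall>b\<in>alphabet A. step A q b \<in> locs A)"

primrec run :: "('q, 'b, 'l) vdra \<Rightarrow> (nat \<Rightarrow> 'b) \<Rightarrow> nat \<Rightarrow> 'q" where
  "run A w 0 = start A"
| "run A w (Suc i) = step A (run A w i) (w i)"

definition rabin_language ::
  "('q, 'b, 'l::residual_de_morgan_algebra) vdra \<Rightarrow> (nat \<Rightarrow> 'b) \<Rightarrow> 'l" where
  "rabin_language A w = Sup {acc_val A H K | H K. H \<subseteq> locs A \<and> K \<subseteq> locs A \<and>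
     (\<exists>n. \<forall>m\<ge>n. run A w m \<notin> H) \<and> (\<forall>n. \<exists>m\<ge>n. run A w m \<in> K)}"

definition product ::
  "('s, 'a, 'p, 'l::residual_de_morgan_algebra) mvts \<Rightarrow> ('q, 'p set, 'l) vdra \<Rightarrow>
    ('s \<times> 'q, 'a, 'q set, 'l) mvts" where
  "product TS A = \<lparr>
     states = states TS \<times> locs A,
     acts = acts TS,
     trans_val = (\<lambda>(s, q) \<alpha> (t, p). if step A q (label TS t) = p then trans_val TS s \<alpha> t else bot),
     init_val = (\<lambda>(s, q). if step A (start A) (label TS s) = q then init_val TS s else bot),
     props = Pow (locs A),
     label = (\<lambda>(s, q). {H. H \<subseteq> locs A \<and> q \<in> H})\<rparr>"

definition rabin_property ::
  "('q, 'b, 'l::residual_de_morgan_algebra) vdra \<Rightarrow> (nat \<Rightarrow> 'q set set) \<Rightarrow> 'l" where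
  "rabin_property A B = Sup {acc_val A H K | H K. H \<subseteq> locs A \<and> K \<subseteq> locs A \<and>
     (\<exists>n. \<forall>m\<ge>n. H \<notin> B m) \<and> (\<forall>n. \<exists>m\<ge>n. K \<in> B m)}"

lemma product_is_mvts:
  assumes "is_mvts TS" "is_vdra A"
  shows "is_mvts (product TS A)"
  using assms by (auto simp: is_mvts_def is_vdra_def product_def)

lemma product_no_terminal_states:
  assumes "is_mvts TS" "no_terminal_states TS" "is_vdra A" "alphabet A = Pow (props TS)"
  shows "no_terminal_states (product TS A)"
  unfolding no_terminal_states_def
proof
  fix x assume "x \<in> states (product TS A)"
  then obtain s q where x: "x = (s, q)" "s \<in> states TS" "q \<in> locs A"
    by (auto simp: product_def)
  with assms(2) obtain \<alpha> t where t: "\<alpha> \<in> acts TS" "t \<in> states TS" "trans_val TS s \<alpha> t > bot"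
    by (auto simp: no_terminal_states_def)
  have "step A q (label TS t) \<in> locs A"
    using assms x t by (auto simp: is_mvts_def is_vdra_def)
  then have "(t, step A q (label TS t)) \<in> states (product TS A)"
    using t by (simp add: product_def)
  moreover have "trans_val (product TS A) x \<alpha> (t, step A q (label TS t)) > bot"
    using x t by (simp add: product_def)
  ultimately show "\<exists>\<alpha>\<in>acts (product TS A). \<exists>s'\<in>states (product TS A).
      trans_val (product TS A) x \<alpha> s' > bot"
    using t by (auto simp: product_def)
qed

end

theory Submission
  imports Defs
begin

text \<open>
  Satisfaction can be tested path by path. A path of the product whose automaton component follows
  the run on the trace of its first component has the value of that first component, and its
  acceptance condition is that of the run; every other path of the product has value \<open>bot\<close>.
\<close>

lemma path_trace_in_omega_words:
  assumes "is_mvts TS" "\<rho> \<in> paths TS"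
  shows "path_trace TS \<rho> \<in> omega_words (Pow (props TS))"
  using assms by (cases \<rho>) (auto simp: is_mvts_def paths_def omega_words_def)

text \<open>\<open>traces\<close> is a supremum of path values, so it lies below a bound exactly
  when each of these values does; a word that is the trace of no path has the value
  \<open>bot\<close>.\<close>

lemma satisfies_iff_paths:
  assumes "is_mvts TS"
  shows "satisfies TS P \<longleftrightarrow> (\<forall>\<rho>\<in>paths TS. path_val TS \<rho> \<le> P (path_trace TS \<rho>))"
proof
  assume sat: "satisfies TS P"
  show "\<forall>\<rho>\<in>paths TS. path_val TS \<rho> \<le> P (path_trace TS \<rho>)"
  proof
    fix \<rho> assume \<rho>: "\<rho> \<in> paths TS"
    then have "path_val TS \<rho> \<le> traces TS (path_trace TS \<rho>)"
      unfolding traces_def by (intro Sup_upper) blast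
    also have "\<dots> \<le> P (path_trace TS \<rho>)"
      using sat path_trace_in_omega_words[OF assms \<rho>] by (simp add: satisfies_def)
    finally show "path_val TS \<rho> \<le> P (path_trace TS \<rho>)" .
  qed
next
  assume "\<forall>\<rho>\<in>paths TS. path_val TS \<rho> \<le> P (path_trace TS \<rho>)"
  then show "satisfies TS P"
    unfolding satisfies_def traces_def by (blast intro: Sup_least)
qed

lemma run_in_locs:
  assumes "is_vdra A" "w \<in> omega_words (alphabet A)"
  shows "run A w i \<in> locs A"
  using assms by (induction i) (auto simp: is_vdra_def omega_words_def)

text \<open>The index is \<open>Suc i\<close> because \<open>init_val\<close> of the product already
  lets the automaton read the label of \<open>s 0\<close>. With this shift both tests in
  \<open>product\<close> are instances of the recursion for \<open>run\<close>, so neither default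
  \<open>bot\<close> is taken.\<close>

lemma product_path_val_run:
  assumes "\<And>i. q i = run A (\<lambda>i. label TS (s i)) (Suc i)"
  shows "path_val (product TS A) (\<lambda>i. (s i, q i), a) = path_val TS (s, a)"
  using assms by (simp add: product_def)

text \<open>A meet different from \<open>bot\<close> has no factor equal to \<open>bot\<close>. Then
  every test in \<open>product\<close> succeeds, and these tests determine \<open>q\<close>
  recursively as the run.\<close>

lemma product_path_val_not_run:
  assumes "\<exists>i. q i \<noteq> run A (\<lambda>i. label TS (s i)) (Suc i)"
  shows "path_val (product TS A) (\<lambda>i. (s i, q i), a) = bot"
proof (rule ccontr)
  assume nz: "path_val (product TS A) (\<lambda>i. (s i, q i), a) \<noteq> bot"
  have "init_val (product TS A) (s 0, q 0) \<noteq> bot"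
    using nz by auto
  then have init: "q 0 = step A (start A) (label TS (s 0))"
    by (auto simp: product_def split: if_splits)
  have step: "q (Suc i) = step A (q i) (label TS (s (Suc i)))" for i
  proof (rule ccontr)
    assume "q (Suc i) \<noteq> step A (q i) (label TS (s (Suc i)))"
    then have "trans_val (product TS A) (s i, q i) (a i) (s (Suc i), q (Suc i)) = bot"
      by (auto simp: product_def)
    \<comment> \<open>A single failed transition pulls the whole infimum down to
      \<open>bot\<close>.\<close>
    then have "(INF i. trans_val (product TS A) (s i, q i) (a i) (s (Suc i), q (Suc i))) \<le> bot"
      using INF_lower[of i UNIV "\<lambda>i. trans_val (product TS A) (s i, q i) (a i) (s (Suc i), q (Suc i))"]
      by simp
    then show False
      using nz by (simp add: bot_unique)
  qed
  have "q i = run A (\<lambda>i. label TS (s i)) (Suc i)" for i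
    by (induction i) (simp_all add: init step)
  with assms show False by blast
qed

text \<open>This absorbs the offset by one between product paths and runs: what holds eventually
  does not depend on the first position.\<close>

lemma eventually_Suc_shift: "(\<exists>n. \<forall>m\<ge>n. R (Suc m)) \<longleftrightarrow> (\<exists>n::nat. \<forall>m\<ge>n. R m)"
proof
  assume "\<exists>n. \<forall>m\<ge>n. R (Suc m)"
  then obtain n where n: "R (Suc m)" if "m \<ge> n" for m by blast
  have "R m" if "m \<ge> Suc n" for m
    using that n by (cases m) auto
  then show "\<exists>n. \<forall>m\<ge>n. R m" by blast
qed (metis le_SucI)

text \<open>A product label collects the sets that contain the current location, so membership of
  \<open>H\<close> in a letter says that the run is in \<open>H\<close>, one position later. Limit
  conditions do not see this delay.\<close>

lemma rabin_property_product_trace: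
  fixes A :: "('q, 'p set, 'l::residual_de_morgan_algebra) vdra"
  assumes "\<And>i. q i = run A (\<lambda>i. label TS (s i)) (Suc i)"
  shows "rabin_property A (path_trace (product TS A) (\<lambda>i. (s i, q i), a)) =
    rabin_language A (path_trace TS (s, a))"
proof -
  let ?r = "run A (\<lambda>i. label TS (s i))"
  let ?B = "path_trace (product TS A) (\<lambda>i. (s i, q i), a)"
  have mem: "H \<in> ?B m \<longleftrightarrow> ?r (Suc m) \<in> H" if "H \<subseteq> locs A" for H m
    using that assms by (simp add: product_def)
  have fin: "(\<exists>n. \<forall>m\<ge>n. H \<notin> ?B m) \<longleftrightarrow> (\<exists>n. \<forall>m\<ge>n. ?r m \<notin> H)" if "H \<subseteq> locs A" for H
    unfolding mem[OF that] by (rule eventually_Suc_shift)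
  \<comment> \<open>Visiting \<open>K\<close> infinitely often is the negation of eventually
    avoiding \<open>K\<close>, so \<open>fin\<close> is applied to \<open>K\<close>.\<close>
  have inf: "(\<forall>n. \<exists>m\<ge>n. K \<in> ?B m) \<longleftrightarrow> (\<forall>n. \<exists>m\<ge>n. ?r m \<in> K)" if "K \<subseteq> locs A" for K
    using fin[OF that] by blast
  show ?thesis
    unfolding rabin_property_def rabin_language_def path_trace.simps[of TS]
    \<comment> \<open>\<open>conj_cong\<close> hands the inclusions in \<open>locs A\<close> on to
      \<open>fin\<close> and \<open>inf\<close>.\<close>
    by (intro arg_cong[where f = Sup] Collect_cong ex_cong1 conj_cong refl fin inf)
qed

theorem theorem6:
  fixes TS :: "('s, 'a, 'p, 'l::residual_de_morgan_algebra) mvts"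
    and P :: "(nat \<Rightarrow> 'p set) \<Rightarrow> 'l"
    and A :: "('q, 'p set, 'l) vdra"
  assumes "is_mvts TS"
    and "no_terminal_states TS"
    and "is_vdra A"
    and "alphabet A = Pow (props TS)"
    and "\<forall>\<sigma>\<in>omega_words (Pow (props TS)). rabin_language A \<sigma> = P \<sigma>"
  shows "satisfies TS P \<longleftrightarrow> satisfies (product TS A) (rabin_property A)"
proof -
  note product_mvts = product_is_mvts[OF assms(1,3)]
  \<comment> \<open>The assumption equates \<open>P\<close> with the language on words over
    \<open>Pow (props TS)\<close>, and traces of paths are such words.\<close>
  have P_trace: "P (path_trace TS \<rho>) = rabin_language A (path_trace TS \<rho>)" if "\<rho> \<in> paths TS" for \<rho>
    using assms(5) path_trace_in_omega_words[OF assms(1) that] by simp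
  show ?thesis
    unfolding satisfies_iff_paths[OF assms(1)] satisfies_iff_paths[OF product_mvts]
  proof (intro iffI ballI)
    fix \<rho>
    assume le: "\<forall>\<rho>\<in>paths TS. path_val TS \<rho> \<le> P (path_trace TS \<rho>)"
      and \<rho>: "\<rho> \<in> paths (product TS A)"
    define s q a where "s = fst \<circ> fst \<rho>" and "q = snd \<circ> fst \<rho>" and "a = snd \<rho>"
    have \<rho>_eq: "\<rho> = (\<lambda>i. (s i, q i), a)"
      by (simp add: s_def q_def a_def)
    have path: "(s, a) \<in> paths TS"
      using \<rho> by (auto simp: \<rho>_eq paths_def omega_words_def product_def)
    show "path_val (product TS A) \<rho> \<le> rabin_property A (path_trace (product TS A) \<rho>)"
    proof (cases "\<forall>i. q i = run A (\<lambda>i. label TS (s i)) (Suc i)")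
      case True
      then have run: "q i = run A (\<lambda>i. label TS (s i)) (Suc i)" for i
        by (rule spec)
      have "path_val (product TS A) \<rho> = path_val TS (s, a)"
        unfolding \<rho>_eq by (rule product_path_val_run[OF run])
      also have "\<dots> \<le> rabin_language A (path_trace TS (s, a))"
        unfolding P_trace[OF path, symmetric] using le path by blast
      also have "\<dots> = rabin_property A (path_trace (product TS A) \<rho>)"
        unfolding \<rho>_eq by (rule rabin_property_product_trace[OF run, symmetric])
      finally show ?thesis .
    next
      case False
      then have "path_val (product TS A) \<rho> = bot"
        unfolding \<rho>_eq by (intro product_path_val_not_run) blast
      then show ?thesis by simp
    qed
  next
    fix \<rho>
    assume le: "\<forall>\<rho>\<in>paths (product TS A).
        path_val (product TS A) \<rho> \<le> rabin_property A (path_trace (product TS A) \<rho>)"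
      and \<rho>: "\<rho> \<in> paths TS"
    obtain s a where \<rho>_eq: "\<rho> = (s, a)" by fastforce
    \<comment> \<open>The path is lifted to the product by pairing each state with the location
      reached after reading its label. These locations stay in \<open>locs A\<close> since the
      labels are letters of the alphabet.\<close>
    define q where "q = (\<lambda>i. run A (\<lambda>i. label TS (s i)) (Suc i))"
    have "q i \<in> locs A" for i
      unfolding q_def using path_trace_in_omega_words[OF assms(1) \<rho>] assms(4)
      by (intro run_in_locs[OF assms(3)]) (simp add: \<rho>_eq)
    then have path: "(\<lambda>i. (s i, q i), a) \<in> paths (product TS A)"
      using \<rho> by (auto simp: \<rho>_eq paths_def omega_words_def product_def)
    have "path_val TS \<rho> = path_val (product TS A) (\<lambda>i. (s i, q i), a)"
      unfolding \<rho>_eq by (rule product_path_val_run[symmetric]) (simp only: q_def)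
    also have "\<dots> \<le> rabin_property A (path_trace (product TS A) (\<lambda>i. (s i, q i), a))"
      using le path by blast
    also have "\<dots> = rabin_language A (path_trace TS \<rho>)"
      unfolding \<rho>_eq by (rule rabin_property_product_trace) (simp only: q_def)
    also have "\<dots> = P (path_trace TS \<rho>)"
      using P_trace[OF \<rho>] by simp
    finally show "path_val TS \<rho> \<le> P (path_trace TS \<rho>)" .
  qed
qed

end
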